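(* Let $\nu>0$ and suppose that $f=h+\overline g\in\mathcal{B}^*_H(\nu)$ is sense-preserving in $\mathbb{D}$ with dilatation $\omega_f$, where $h(z)=\sum_{n=0}^\infty a_nz^n$ and $g(z)=\sum_{n=1}^\infty b_nz^n$. Then $$|b_1|<|a_1|\le\frac{\beta^*_\nu(f)}{\sqrt{1-|\omega_f(0)|^2}},$$ and $$\max\{|a_n|,|b_n|\}\le\beta^*_\nu(f)\left(\frac{e}{2\nu+1}\right)^{\nu+1/2}\sqrt{\frac{1+|\omega_f(0)|}{1-|\omega_f(0)|}}\,(n+2\nu)^{\nu-1/2},\qquad n\ge2.$$
   Context: $\mathbb{D}$ is the open unit disk in $\mathbb{C}$. A harmonic mapping in $\mathbb{D}$ is a complex-valued $f$ with $f_{z\overline z}=0$; its canonical decomposition is $f=h+\overline g$ with $h,g$ analytic in $\mathbb{D}$, $g(0)=0$. Its Jacobian is $J_f=|h'|^2-|g'|^2$. It is sense-preserving when $J_f>0$ in $\mathbb{D}$, i.e. $|g'|<|h'|$; its dilatation is $\omega_f=g'/h'$. $\beta^*_\nu(f)=\sup_{z\in\mathbb{D}}(1-|z|^2)^\nu\sqrt{|J_f(z)|}$, and $\mathcal{B}^*_H(\nu)$ is the set of harmonic mappings $f$ in $\mathbb{D}$ with $\beta^*_\nu(f)<\infty$. *)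

theory Defs
  imports "HOL-Complex_Analysis.Complex_Analysis"
begin

abbreviation unit_disk :: "complex set" (\<open>\<bbbD>\<close>)
  where "\<bbbD> \<equiv> ball 0 1"

subsection \<open>Harmonic mappings\<close>

(* f_z = (f_x - i f_y) / 2 and f_zbar = (f_x + i f_y) / 2, where f_x and f_y are the values of the
   real derivative of f at 1 and at i. *)
definition wirtinger_z :: "(complex \<Rightarrow> complex) \<Rightarrow> complex \<Rightarrow> complex" where
  "wirtinger_z f z =
     (frechet_derivative f (at z) 1 - \<i> * frechet_derivative f (at z) \<i>) / 2"

definition wirtinger_zbar :: "(complex \<Rightarrow> complex) \<Rightarrow> complex \<Rightarrow> complex" where
  "wirtinger_zbar f z =
     (frechet_derivative f (at z) 1 + \<i> * frechet_derivative f (at z) \<i>) / 2"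

(* "differentiable" is real differentiability here, so that the first two conditions say that
   f is twice continuously differentiable in the real sense. *)
definition harmonic_mapping :: "(complex \<Rightarrow> complex) \<Rightarrow> bool" where
  "harmonic_mapping f \<longleftrightarrow>
     (\<forall>z\<in>\<bbbD>. f differentiable (at z) \<and>
        wirtinger_z f differentiable (at z) \<and> wirtinger_zbar f differentiable (at z)) \<and>
     (\<forall>u\<in>{wirtinger_z f, wirtinger_zbar f}.
        continuous_on \<bbbD> (wirtinger_z u) \<and> continuous_on \<bbbD> (wirtinger_zbar u)) \<and>
     (\<forall>z\<in>\<bbbD>. wirtinger_zbar (wirtinger_z f) z = 0)"

definition canonical_decomposition ::
    "(complex \<Rightarrow> complex) \<Rightarrow> (complex \<Rightarrow> complex) \<Rightarrow> (complex \<Rightarrow> complex) \<Rightarrow> bool" where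
  "canonical_decomposition f h g \<longleftrightarrow>
     h holomorphic_on \<bbbD> \<and> g holomorphic_on \<bbbD> \<and> g 0 = 0 \<and>
     (\<forall>z\<in>\<bbbD>. f z = h z + cnj (g z))"

(* The canonical decomposition is unique on the disk, so the choices made here do not affect the
   derivatives there; see canonical_parts_deriv below. *)
definition analytic_part :: "(complex \<Rightarrow> complex) \<Rightarrow> complex \<Rightarrow> complex" where
  "analytic_part f = (SOME h. \<exists>g. canonical_decomposition f h g)"

definition coanalytic_part :: "(complex \<Rightarrow> complex) \<Rightarrow> complex \<Rightarrow> complex" where
  "coanalytic_part f = (SOME g. \<exists>h. canonical_decomposition f h g)"

definition jacobian :: "(complex \<Rightarrow> complex) \<Rightarrow> complex \<Rightarrow> real" where
  "jacobian f z =
     (cmod (deriv (analytic_part f) z))\<^sup>2 - (cmod (deriv (coanalytic_part f) z))\<^sup>2"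

definition sense_preserving :: "(complex \<Rightarrow> complex) \<Rightarrow> bool" where
  "sense_preserving f \<longleftrightarrow> (\<forall>z\<in>\<bbbD>. jacobian f z > 0)"

definition dilatation :: "(complex \<Rightarrow> complex) \<Rightarrow> complex \<Rightarrow> complex" where
  "dilatation f z = deriv (coanalytic_part f) z / deriv (analytic_part f) z"

subsection \<open>Bloch-type mappings\<close>

definition bloch_weight :: "real \<Rightarrow> (complex \<Rightarrow> complex) \<Rightarrow> complex \<Rightarrow> real" where
  "bloch_weight \<nu> f z = (1 - (cmod z)\<^sup>2) powr \<nu> * sqrt \<bar>jacobian f z\<bar>"

(* The supremum is a real number, and meaningful only for members of bloch_type. *)
definition bloch_const :: "real \<Rightarrow> (complex \<Rightarrow> complex) \<Rightarrow> real" where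
  "bloch_const \<nu> f = (SUP z\<in>\<bbbD>. bloch_weight \<nu> f z)"

(* Finiteness of the supremum is expressed as boundedness. *)
definition bloch_type :: "real \<Rightarrow> (complex \<Rightarrow> complex) set" where
  "bloch_type \<nu> = {f. harmonic_mapping f \<and> bdd_above (bloch_weight \<nu> f ` \<bbbD>)}"

subsection \<open>Well-definedness\<close>

lemma wirtinger_sum_cnj:
  assumes h: "h holomorphic_on \<bbbD>" and g: "g holomorphic_on \<bbbD>"
    and f: "\<And>w. w \<in> \<bbbD> \<Longrightarrow> f w = h w + cnj (g w)" and z: "z \<in> \<bbbD>"
  shows "f differentiable (at z)" "wirtinger_z f z = deriv h z"
    "wirtinger_zbar f z = cnj (deriv g z)"
proof -
  have "(h has_derivative (\<lambda>v. deriv h z * v)) (at z)"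
    "(g has_derivative (\<lambda>v. deriv g z * v)) (at z)"
    using holomorphic_derivI[OF h open_ball z] holomorphic_derivI[OF g open_ball z]
    by (simp_all add: has_field_derivative_def)
  then have "((\<lambda>w. h w + cnj (g w)) has_derivative (\<lambda>v. deriv h z * v + cnj (deriv g z * v))) (at z)"
    by (intro has_derivative_add has_derivative_cnj)
  then have D: "(f has_derivative (\<lambda>v. deriv h z * v + cnj (deriv g z * v))) (at z)"
    by (rule has_derivative_transform_within_open[OF _ open_ball z]) (simp add: f)
  then show "f differentiable (at z)"
    by (auto simp: differentiable_def)
  have "frechet_derivative f (at z) = (\<lambda>v. deriv h z * v + cnj (deriv g z * v))"
    using frechet_derivative_at[OF D] by simp
  then show "wirtinger_z f z = deriv h z" "wirtinger_zbar f z = cnj (deriv g z)"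
    by (simp_all add: wirtinger_z_def wirtinger_zbar_def algebra_simps)
qed

lemma canonical_parts_deriv:
  assumes fhg: "canonical_decomposition f h g" and z: "z \<in> \<bbbD>"
  shows "deriv (analytic_part f) z = deriv h z" "deriv (coanalytic_part f) z = deriv g z"
proof -
  have W: "wirtinger_z f z = deriv h' z \<and> wirtinger_zbar f z = cnj (deriv g' z)"
    if "canonical_decomposition f h' g'" for h' g'
    using that wirtinger_sum_cnj[of h' g' f z] z by (auto simp: canonical_decomposition_def)
  obtain g' where "canonical_decomposition f (analytic_part f) g'"
    using fhg unfolding analytic_part_def by (metis (mono_tags, lifting) someI_ex)
  then show "deriv (analytic_part f) z = deriv h z"
    using W fhg by metis
  obtain h' where "canonical_decomposition f h' (coanalytic_part f)"
    using fhg unfolding coanalytic_part_def by (metis (mono_tags, lifting) someI_ex)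
  then show "deriv (coanalytic_part f) z = deriv g z"
    using W fhg by (metis complex_cnj_cancel_iff)
qed

lemma jacobian_eq:
  assumes "canonical_decomposition f h g" "z \<in> \<bbbD>"
  shows "jacobian f z = (cmod (deriv h z))\<^sup>2 - (cmod (deriv g z))\<^sup>2"
  by (simp add: jacobian_def canonical_parts_deriv[OF assms])

lemma dilatation_eq:
  assumes "canonical_decomposition f h g" "z \<in> \<bbbD>"
  shows "dilatation f z = deriv g z / deriv h z"
  by (simp add: dilatation_def canonical_parts_deriv[OF assms])

lemma canonical_decomposition_imp_harmonic_mapping:
  assumes "canonical_decomposition f h g"
  shows "harmonic_mapping f"
proof -
  have hol: "h holomorphic_on \<bbbD>" "g holomorphic_on \<bbbD>"
    and f: "\<And>z. z \<in> \<bbbD> \<Longrightarrow> f z = h z + cnj (g z)"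
    using assms by (auto simp: canonical_decomposition_def)
  have hol': "deriv h holomorphic_on \<bbbD>" "deriv g holomorphic_on \<bbbD>"
    and hol'': "deriv (deriv h) holomorphic_on \<bbbD>" "deriv (deriv g) holomorphic_on \<bbbD>"
    using hol by (simp_all add: holomorphic_deriv)
  note 0 = wirtinger_sum_cnj[OF hol f]
  have zero: "(\<lambda>_. 0) holomorphic_on \<bbbD>"
    by simp
  note 1 = wirtinger_sum_cnj[OF hol'(1) zero, of "wirtinger_z f"]
  note 2 = wirtinger_sum_cnj[OF zero hol'(2), of "wirtinger_zbar f"]
  have "continuous_on \<bbbD> (deriv (deriv h))" "continuous_on \<bbbD> (\<lambda>z. cnj (deriv (deriv g) z))"
    using hol'' by (simp_all add: continuous_on_cnj holomorphic_on_imp_continuous_on)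
  then have "continuous_on \<bbbD> (wirtinger_z (wirtinger_z f))"
    "continuous_on \<bbbD> (wirtinger_zbar (wirtinger_zbar f))"
    using 0 1 2 by (simp_all cong: continuous_on_cong_simp)
  moreover have "continuous_on \<bbbD> (wirtinger_zbar (wirtinger_z f))"
    "continuous_on \<bbbD> (wirtinger_z (wirtinger_zbar f))"
    using 0 1 2 by (simp_all cong: continuous_on_cong_simp)
  ultimately show ?thesis
    using 0 1 2 by (simp add: harmonic_mapping_def)
qed

end

theory Submission
  imports Defs
begin

text \<open>Schwarz--Pick bounds \<open>1 - |\<omega>|\<^sup>2\<close> from below by \<open>(1 - |z|\<^sup>2) (1 - |\<omega>(0)|) / (1 + |\<omega>(0)|)\<close>. As
  \<open>J\<^sub>f = |h'|\<^sup>2 (1 - |\<omega>|\<^sup>2)\<close>, membership in the Bloch-type class turns this into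
  \<open>|g'| < |h'| \<le> C (1 - |z|\<^sup>2) powr -(\<nu> + 1/2)\<close>, and Cauchy's estimate for \<open>h'\<close> and \<open>g'\<close> on
  \<open>|z|\<^sup>2 = (n - 1) / (n + 2 \<nu>)\<close> bounds \<open>n |a\<^sub>n|\<close> and \<open>n |b\<^sub>n|\<close>. The crude estimate
  \<open>(1 + s / m) ^ m \<le> exp s\<close> would lose a factor \<open>(n + 2 \<nu>) / n\<close> here, so the radius has to be
  substituted into a sharper inequality.\<close>

section \<open>Schwarz--Pick estimates on the disk\<close>

text \<open>Expanding squares in real coordinates gives |1 - cnj w * z|^2 - |z - w|^2 = (1 - |w|^2)
  (1 - |z|^2); it remains to divide by |1 - cnj w * z|^2.\<close>

lemma one_minus_norm_Moebius_square:
  assumes w: "cmod w < 1" and z: "cmod z < 1"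
  shows "1 - (cmod (Moebius_function 0 w z))\<^sup>2 =
    (1 - (cmod w)\<^sup>2) * (1 - (cmod z)\<^sup>2) / (cmod (1 - cnj w * z))\<^sup>2"
proof -
  have "cmod (cnj w * z) < 1"
    using norm_mult_less[of "cnj w" 1 z 1] w z by simp
  then have ne: "1 - cnj w * z \<noteq> 0"
    by auto
  have "(cmod (1 - cnj w * z))\<^sup>2 - (cmod (z - w))\<^sup>2 = (1 - (cmod w)\<^sup>2) * (1 - (cmod z)\<^sup>2)"
    by (simp only: cmod_power2) (simp add: algebra_simps power2_eq_square)
  then show ?thesis
    using ne by (simp add: Moebius_function_simple norm_divide power_divide field_simps)
qed

text \<open>The Schwarz lemma is applied to the composition
  of \<open>\<omega>\<close> with the disk automorphism that sends \<open>\<omega> 0\<close> to \<open>0\<close>.\<close>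

lemma Schwarz_Pick_one_minus_norm_square:
  assumes hol: "\<omega> holomorphic_on \<bbbD>" and bd: "\<And>z. cmod z < 1 \<Longrightarrow> cmod (\<omega> z) < 1"
    and z: "cmod z < 1"
  shows "(1 - (cmod z)\<^sup>2) * ((1 - cmod (\<omega> 0)) / (1 + cmod (\<omega> 0))) \<le> 1 - (cmod (\<omega> z))\<^sup>2"
proof -
  define w where "w = \<omega> 0"
  define d where "d = cmod (1 - cnj w * \<omega> z)"
  have w: "cmod w < 1"
    unfolding w_def by (rule bd) simp
  have "cmod ((Moebius_function 0 w \<circ> \<omega>) z) \<le> cmod z"
  proof (rule Schwarz_Lemma(1)[OF _ _ _ z])
    show "Moebius_function 0 w \<circ> \<omega> holomorphic_on \<bbbD>"
      using bd by (intro holomorphic_on_compose_gen[OF hol Moebius_function_holomorphic[OF w]]) auto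
    show "(Moebius_function 0 w \<circ> \<omega>) 0 = 0"
      by (simp add: w_def Moebius_function_eq_zero)
    show "cmod ((Moebius_function 0 w \<circ> \<omega>) u) < 1" if "cmod u < 1" for u
      using Moebius_function_norm_lt_1[OF w bd[OF that]] by simp
  qed
  then have "1 - (cmod z)\<^sup>2 \<le> 1 - (cmod (Moebius_function 0 w (\<omega> z)))\<^sup>2"
    by (simp add: power_mono)
  also have "\<dots> = (1 - (cmod w)\<^sup>2) * (1 - (cmod (\<omega> z))\<^sup>2) / d\<^sup>2"
    unfolding d_def by (rule one_minus_norm_Moebius_square[OF w bd[OF z]])
  finally have P: "1 - (cmod z)\<^sup>2 \<le> (1 - (cmod w)\<^sup>2) * (1 - (cmod (\<omega> z))\<^sup>2) / d\<^sup>2" .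
  \<comment> \<open>Only |\<open>\<omega> z\<close>| < 1 enters the bound for \<open>d\<close>, so
    the final estimate depends on \<open>\<omega> 0\<close> alone.\<close>
  have "cmod (cnj w * \<omega> z) \<le> cmod w"
    using bd[OF z] by (simp add: norm_mult mult_left_le)
  then have d: "1 - cmod w \<le> d"
    unfolding d_def using norm_triangle_ineq2[of 1 "cnj w * \<omega> z"] by simp
  then have d0: "0 < d"
    using w by simp
  have wp: "0 < 1 - (cmod w)\<^sup>2"
    using w by (simp add: power_less_one_iff abs_square_less_1)
  have zp: "0 \<le> 1 - (cmod z)\<^sup>2"
    using z by (simp add: abs_square_le_1)
  have "(1 - (cmod z)\<^sup>2) * ((1 - cmod w) / (1 + cmod w)) =
      (1 - (cmod z)\<^sup>2) * (1 - cmod w)\<^sup>2 / (1 - (cmod w)\<^sup>2)"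
  proof -
    have "1 - (cmod w)\<^sup>2 = (1 - cmod w) * (1 + cmod w)"
      by (simp add: algebra_simps power2_eq_square)
    then show ?thesis
      using w by (simp add: power2_eq_square)
  qed
  also have "\<dots> \<le> (1 - (cmod z)\<^sup>2) * d\<^sup>2 / (1 - (cmod w)\<^sup>2)"
    using d w wp zp by (intro divide_right_mono mult_left_mono power_mono) auto
  also have "\<dots> \<le> 1 - (cmod (\<omega> z))\<^sup>2"
    using P d0 wp by (simp add: field_simps)
  finally show ?thesis
    by (simp add: w_def)
qed

section \<open>Taylor coefficients and Cauchy's estimate\<close>

lemma powser_nth_eq_higher_deriv:
  fixes a :: "nat \<Rightarrow> complex"
  assumes "\<And>z. z \<in> \<bbbD> \<Longrightarrow> (\<lambda>n. a n * z ^ n) sums h z"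
  shows "a n = (deriv ^^ n) h 0 / fact n"
proof -
  have "h has_fps_expansion Abs_fps a"
    by (rule has_fps_expansionI) (use assms eventually_nhds_in_open[of \<bbbD> 0] in \<open>auto elim!: eventually_mono\<close>)
  then show ?thesis
    using fps_nth_fps_expansion by fastforce
qed

text \<open>Cauchy's inequality is applied to the derivative of \<open>h\<close>, whose coefficient
  of index \<open>m\<close> is (m + 1) times \<open>a (Suc m)\<close>. Hence the power of
  \<open>r\<close> is \<open>m\<close>.\<close>

lemma powser_nth_bound:
  assumes hol: "h holomorphic_on \<bbbD>"
    and sums: "\<And>z. z \<in> \<bbbD> \<Longrightarrow> (\<lambda>n. a n * z ^ n) sums h z"
    and r: "0 < r" "r < 1"
    and B: "\<And>z. cmod z = r \<Longrightarrow> cmod (deriv h z) \<le> B"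
  shows "real (Suc m) * cmod (a (Suc m)) \<le> B / r ^ m"
proof -
  have "deriv h holomorphic_on \<bbbD>"
    using hol by (simp add: holomorphic_deriv)
  then have hol': "deriv h holomorphic_on cball 0 r"
    by (rule holomorphic_on_subset) (use r in auto)
  have "cmod ((deriv ^^ m) (deriv h) 0) \<le> fact m * B / r ^ m"
  proof (rule Cauchy_inequality[OF _ _ r(1)])
    show "deriv h holomorphic_on ball 0 r"
      using hol' by (rule holomorphic_on_subset) auto
    show "continuous_on (cball 0 r) (deriv h)"
      using hol' by (rule holomorphic_on_imp_continuous_on)
  qed (use B in auto)
  moreover have "a (Suc m) = (deriv ^^ m) (deriv h) 0 / fact (Suc m)"
    using powser_nth_eq_higher_deriv[of a h "Suc m"] sums
    by (simp only: funpow_Suc_right comp_apply)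
  then have "real (Suc m) * cmod (a (Suc m)) = cmod ((deriv ^^ m) (deriv h) 0) / fact m"
    by (simp add: norm_divide norm_mult del: of_nat_Suc)
  ultimately have "real (Suc m) * cmod (a (Suc m)) \<le> fact m * B / r ^ m / fact m"
    by (simp only: divide_right_mono fact_ge_zero)
  then show ?thesis
    by simp
qed

section \<open>The real inequality behind the choice of radius\<close>

text \<open>The right side minus the left vanishes at 0 and has derivative -ln (1 - t^2) \<ge>
  0.\<close>

lemma entropy_difference_le:
  fixes t :: real
  assumes "0 \<le> t" "t < 1"
  shows "(1 + t) * ln (1 + t) - (1 - t) * ln (1 - t) \<le> 2 * t"
proof -
  define G where "G = (\<lambda>x::real. 2 * x - (1 + x) * ln (1 + x) + (1 - x) * ln (1 - x))"
  have "G 0 \<le> G t"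
  proof (rule DERIV_nonneg_imp_nondecreasing[OF assms(1)])
    fix x assume x: "0 \<le> x" "x \<le> t"
    then have x1: "x < 1"
      using assms by simp
    have "(G has_real_derivative - (ln (1 + x) + ln (1 - x))) (at x)"
      unfolding G_def using x x1 by (auto intro!: derivative_eq_intros)
    moreover have "ln (1 + x) + ln (1 - x) \<le> 0"
      using x x1 ln_add_one_self_le_self[of x] ln_one_minus_pos_upper_bound[of x] by linarith
    ultimately show "\<exists>y. (G has_real_derivative y) (at x) \<and> 0 \<le> y"
      by auto
  qed
  then show ?thesis
    by (simp add: G_def)
qed

text \<open>For fixed \<open>m\<close> the left-hand side minus \<open>s/2\<close> is maximal at \<open>s = 2\<close>; at this value the
  inequality is the previous lemma with \<open>t = 1 / (m + 1)\<close>.\<close>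

lemma ln_optimal_radius_le:
  fixes m s :: real
  assumes m: "m > 0" and s: "s > 0"
  shows "(m / 2 + 1) * ln (m + s) - m / 2 * ln m - ln (m + 1) \<le> s / 2"
proof -
  define t where "t = 1 / (m + 1)"
  have t: "0 \<le> t" "t < 1" and tm: "1 + t = (m + 2) / (m + 1)" "1 - t = m / (m + 1)"
    using m by (auto simp: t_def field_simps)
  have "(m + 2) / (m + 1) * ln ((m + 2) / (m + 1)) - m / (m + 1) * ln (m / (m + 1)) \<le> 2 / (m + 1)"
    using entropy_difference_le[OF t] unfolding tm by (simp add: t_def)
  then have "((m + 2) * ln ((m + 2) / (m + 1)) - m * ln (m / (m + 1))) / (m + 1) \<le> 2 / (m + 1)"
    by (simp add: diff_divide_distrib)
  then have "(m + 2) * ln ((m + 2) / (m + 1)) - m * ln (m / (m + 1)) \<le> 2"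
    using m by (subst (asm) divide_le_cancel) auto
  then have 2: "(m / 2 + 1) * ln (m + 2) - m / 2 * ln m - ln (m + 1) \<le> 1"
    using m by (simp add: ln_div algebra_simps)
  \<comment> \<open>This is the tangent bound at s = 2 for the concave function ln (m + s); after
    multiplication by m / 2 + 1 the tangent has slope exactly 1/2.\<close>
  have "ln ((m + s) / (m + 2)) \<le> (m + s) / (m + 2) - 1"
    using m s by (intro ln_le_minus_one) auto
  also have "\<dots> = (s - 2) / (m + 2)"
    using m by (simp add: field_simps)
  finally have "(m / 2 + 1) * (ln (m + s) - ln (m + 2)) \<le> (m / 2 + 1) * ((s - 2) / (m + 2))"
    using m s by (intro mult_left_mono) (auto simp: ln_div)
  also have "\<dots> = (s - 2) / 2"
    using m by (simp add: field_simps)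
  finally show ?thesis
    using 2 by (simp add: algebra_simps)
qed

text \<open>This \<open>r\<close> maximizes r^m (1 - r^2)^(s/2) on (0, 1), hence minimizes the
  Cauchy bound. Taking logarithms reduces the claim to \<open>ln_optimal_radius_le\<close>.\<close>

lemma optimal_radius_le:
  fixes s :: real
  assumes m: "m > 0" and s: "s > 0"
  defines "r \<equiv> sqrt (real m / (real m + s))"
  shows "1 / (real (Suc m) * r ^ m * (1 - r\<^sup>2) powr (s / 2)) \<le>
    (exp 1 / s) powr (s / 2) * (real m + s) powr (s / 2 - 1)"
proof -
  let ?L = "real (Suc m) * r ^ m * (1 - r\<^sup>2) powr (s / 2)"
  let ?R = "(exp 1 / s) powr (s / 2) * (real m + s) powr (s / 2 - 1)"
  have m': "real m > 0"
    using m by simp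
  have r0: "0 < r"
    unfolding r_def using m' s by simp
  have r2: "1 - r\<^sup>2 = s / (real m + s)"
    unfolding r_def using m' s by (simp add: field_simps)
  have lnr: "ln r = (ln m - ln (m + s)) / 2"
    unfolding r_def using m' s by (simp add: ln_sqrt ln_div)
  have L: "0 < ?L"
    using r0 s m' by (simp add: r2)
  have "ln (1 / ?L) = - ln (m + 1) - m * ln r - s / 2 * (ln s - ln (m + s))"
    using L r0 s m' by (simp add: ln_div ln_mult ln_realpow ln_powr r2 add.commute)
  also have "\<dots> \<le> s / 2 * (1 - ln s) + (s / 2 - 1) * ln (m + s)"
    using ln_optimal_radius_le[OF m' s] by (simp add: lnr algebra_simps add_divide_distrib diff_divide_distrib)
  also have "\<dots> = ln ?R"
    using s m' by (simp add: ln_mult ln_powr ln_div)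
  finally have "ln (1 / ?L) \<le> ln ?R" .
  then show ?thesis
    using L s m' by (subst (asm) ln_le_cancel_iff) auto
qed

section \<open>Coefficient bounds for sense-preserving Bloch-type mappings\<close>

theorem theorem5:
  fixes \<nu> :: real and f h g :: "complex \<Rightarrow> complex" and a b :: "nat \<Rightarrow> complex"
  assumes "\<nu> > 0"
    and "f \<in> bloch_type \<nu>"
    and "canonical_decomposition f h g"
    and "sense_preserving f"
    and "\<And>z. z \<in> \<bbbD> \<Longrightarrow> (\<lambda>n. a n * z ^ n) sums h z"
    and "\<And>z. z \<in> \<bbbD> \<Longrightarrow> (\<lambda>n. b (Suc n) * z ^ Suc n) sums g z"
  shows "cmod (b 1) < cmod (a 1) \<and>
         cmod (a 1) \<le> bloch_const \<nu> f / sqrt (1 - (cmod (dilatation f 0))\<^sup>2) \<and>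
         (\<forall>n\<ge>2. max (cmod (a n)) (cmod (b n)) \<le>
            bloch_const \<nu> f * (exp 1 / (2 * \<nu> + 1)) powr (\<nu> + 1 / 2) *
            sqrt ((1 + cmod (dilatation f 0)) / (1 - cmod (dilatation f 0))) *
            (real n + 2 * \<nu>) powr (\<nu> - 1 / 2))"
proof -
  let ?\<beta> = "bloch_const \<nu> f" and ?\<omega> = "dilatation f"
  let ?w = "cmod (?\<omega> 0)"
  let ?C = "?\<beta> * sqrt ((1 + ?w) / (1 - ?w))"
  let ?K = "\<lambda>n. (exp 1 / (2 * \<nu> + 1)) powr (\<nu> + 1 / 2) * (real n + 2 * \<nu>) powr (\<nu> - 1 / 2)"
  note dec = assms(3)
  have hol: "h holomorphic_on \<bbbD>" "g holomorphic_on \<bbbD>"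
    using dec by (auto simp: canonical_decomposition_def)
  have less: "cmod (deriv g z) < cmod (deriv h z)" if "z \<in> \<bbbD>" for z
  proof -
    have "(cmod (deriv g z))\<^sup>2 < (cmod (deriv h z))\<^sup>2"
      using assms(4)[unfolded sense_preserving_def, rule_format, OF that] jacobian_eq[OF dec that]
      by simp
    then show ?thesis
      by (rule power2_less_imp_less) simp
  qed
  have \<omega>_less: "cmod (?\<omega> z) < 1" if "z \<in> \<bbbD>" for z
  proof -
    have "0 < cmod (deriv h z)"
      using less[OF that] norm_ge_zero[of "deriv g z"] by linarith
    then show ?thesis
      using less[OF that] dilatation_eq[OF dec that] by (simp add: norm_divide)
  qed
  have "(\<lambda>z. deriv g z / deriv h z) holomorphic_on \<bbbD>"
    by (intro holomorphic_on_divide holomorphic_deriv hol open_ball) (use less in fastforce)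
  then have hol\<omega>: "?\<omega> holomorphic_on \<bbbD>"
    by (rule holomorphic_transform) (simp add: dilatation_eq[OF dec])
  have w1: "?w < 1"
    using \<omega>_less[of 0] by simp
  have J: "sqrt \<bar>jacobian f z\<bar> = cmod (deriv h z) * sqrt (1 - (cmod (?\<omega> z))\<^sup>2)"
    if "z \<in> \<bbbD>" for z
  proof -
    have "deriv h z \<noteq> 0"
      using less[OF that] by auto
    then have "jacobian f z = (cmod (deriv h z))\<^sup>2 * (1 - (cmod (?\<omega> z))\<^sup>2)"
      using jacobian_eq[OF dec that] dilatation_eq[OF dec that]
      by (simp add: norm_divide power_divide right_diff_distrib)
    moreover have "0 < jacobian f z"
      using assms(4) that unfolding sense_preserving_def by blast
    ultimately show ?thesis
      by (simp add: real_sqrt_mult)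
  qed
  have W: "(1 - (cmod z)\<^sup>2) powr \<nu> * (cmod (deriv h z) * sqrt (1 - (cmod (?\<omega> z))\<^sup>2)) \<le> ?\<beta>"
    if "z \<in> \<bbbD>" for z
    using assms(2) cSUP_upper[OF that, of "bloch_weight \<nu> f"] that
    by (simp add: bloch_type_def bloch_const_def bloch_weight_def J)
  have H: "cmod (deriv h z) \<le> ?C / (1 - (cmod z)\<^sup>2) powr (\<nu> + 1 / 2)" if "z \<in> \<bbbD>" for z
  proof -
    let ?x = "1 - (cmod z)\<^sup>2" and ?q = "sqrt ((1 - ?w) / (1 + ?w))"
    have z: "cmod z < 1"
      using that by simp
    have x: "0 < ?x"
      using z by (simp add: abs_square_less_1)
    have "0 < (1 - ?w) / (1 + ?w)"
      using w1 by (simp add: add_pos_nonneg)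
    then have q: "0 < ?q"
      by simp
    \<comment> \<open>The root of the Schwarz--Pick bound: \<open>sqrt ?x\<close> raises the weight
      exponent from \<open>\<nu>\<close> to \<open>\<nu> + 1 / 2\<close>, and \<open>?q\<close>
      moves to the other side as the root in \<open>?C\<close>.\<close>
    have "sqrt ?x * ?q \<le> sqrt (1 - (cmod (?\<omega> z))\<^sup>2)"
      using Schwarz_Pick_one_minus_norm_square[OF hol\<omega> _ z] \<omega>_less
      by (simp flip: real_sqrt_mult)
    then have "?x powr \<nu> * (cmod (deriv h z) * (sqrt ?x * ?q)) \<le>
        ?x powr \<nu> * (cmod (deriv h z) * sqrt (1 - (cmod (?\<omega> z))\<^sup>2))"
      by (intro mult_left_mono) auto
    also note W[OF that]
    finally have "cmod (deriv h z) * ?x powr (\<nu> + 1 / 2) * ?q \<le> ?\<beta>"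
      using x by (simp add: powr_add powr_half_sqrt mult_ac)
    then have "cmod (deriv h z) * ?x powr (\<nu> + 1 / 2) \<le> ?\<beta> / ?q"
      using q by (simp add: pos_le_divide_eq)
    also have "\<dots> = ?C"
      by (simp add: real_sqrt_divide)
    finally show ?thesis
      using x by (simp add: pos_le_divide_eq)
  qed
  \<comment> \<open>The series of \<open>g\<close> starts at index 1 and leaves \<open>b 0\<close>
    arbitrary; \<open>b'\<close> puts 0 there to obtain a full power series.\<close>
  define b' where "b' n = (if n = 0 then 0 else b n)" for n
  have sums_g: "(\<lambda>n. b' n * z ^ n) sums g z" if "z \<in> \<bbbD>" for z
    using sums_Suc[of "\<lambda>n. b' n * z ^ n" "g z"] assms(6)[OF that] by (simp add: b'_def)
  have "a 1 = deriv h 0" "b 1 = deriv g 0"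
    using powser_nth_eq_higher_deriv[OF assms(5), of 1] powser_nth_eq_higher_deriv[OF sums_g, of 1]
    by (simp_all add: b'_def)
  \<comment> \<open>At the origin the weight is 1 and the dilatation is known exactly, so
    Schwarz--Pick is bypassed.\<close>
  moreover have "cmod (deriv h 0) \<le> ?\<beta> / sqrt (1 - ?w\<^sup>2)"
    using W[of 0] w1 by (simp add: pos_le_divide_eq abs_square_less_1)
  moreover have "cmod (a n) \<le> ?C * ?K n \<and> cmod (b n) \<le> ?C * ?K n"
    if n2: "n \<ge> 2" for n
  proof -
    obtain m where n: "n = Suc m" and m: "m > 0"
      using n2 by (cases n) auto
    define s where "s = 2 * \<nu> + 1"
    define r where "r = sqrt (real m / (real m + s))"
    have s: "s > 0"
      using assms(1) by (simp add: s_def)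
    have r: "0 < r" "r < 1"
      using m s by (auto simp: r_def)
    let ?B = "?C / (1 - r\<^sup>2) powr (s / 2)"
    have s2: "s / 2 = \<nu> + 1 / 2" "s / 2 - 1 = \<nu> - 1 / 2" "real m + s = real n + 2 * \<nu>"
      by (auto simp: s_def n field_simps)
    have h: "cmod (deriv h z) \<le> ?B" if "cmod z = r" for z
      using H[of z] that r by (simp add: s2)
    have g: "cmod (deriv g z) \<le> ?B" if "cmod z = r" for z
      using h[OF that] less[of z] that r by simp
    have "0 \<le> ?\<beta>"
      using w1 by (intro order_trans[OF _ W[of 0]]) (simp_all add: abs_square_le_1)
    then have C: "0 \<le> ?C"
      using w1 by simp
    have "cmod c \<le> ?C * ?K n"
      if "real (Suc m) * cmod c \<le> ?B / r ^ m" for c :: complex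
    proof -
      have "cmod c \<le> ?B / r ^ m / real (Suc m)"
        using that by (subst pos_le_divide_eq) (simp_all only: mult.commute of_nat_0_less_iff zero_less_Suc)
      also have "\<dots> = ?C * (1 / (real (Suc m) * r ^ m * (1 - r\<^sup>2) powr (s / 2)))"
        by (simp add: mult_ac)
      also have "\<dots> \<le> ?C * ((exp 1 / s) powr (s / 2) * (real m + s) powr (s / 2 - 1))"
        using optimal_radius_le[OF m s] C unfolding r_def by (intro mult_left_mono)
      also have "\<dots> = ?C * ?K n"
        unfolding s2(2,3) unfolding s2(1) by (simp only: s_def)
      finally show ?thesis .
    qed
    note bound = this
    show ?thesis
      using bound[OF powser_nth_bound[OF hol(1) assms(5) r h, of m]]
        bound[OF powser_nth_bound[OF hol(2) sums_g r g, of m]]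
      by (simp add: b'_def n)
  qed
  ultimately show ?thesis
    using less[of 0] by (simp add: mult_ac)
qed

end
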